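(* Let $A,B>0$ be bounded linear operators on a Hilbert space $\mathcal{H}$ such that $mI\le A,B\le MI$ for some scalars $0<m<M$, let $v\in[0,1]$, and put $h=\frac{M}{m}$. Then $$A\nabla_v B-A\sharp_v B\le \max\left\{g_v(h),g_v\left(\tfrac1h\right)\right\}A\le L(1,h)\,\log S(h)\,A,$$ where $g_v(x)=(1-v)+vx-x^v$ for $x>0$.
   Context: Operators are bounded linear operators on a Hilbert space $\mathcal{H}$ with identity $I$. $A\ge 0$ (positive) means $\langle Ax,x\rangle\ge 0$ for all $x\in\mathcal{H}$; $A>0$ (strictly positive) means $A$ is positive and invertible; for self-adjoint $A,B$, $A\le B$ means $B-A\ge 0$. For $A,B>0$ and $v\in[0,1]$: $A\nabla_v B=(1-v)A+vB$ and $A\sharp_v B=A^{1/2}\left(A^{-1/2}BA^{-1/2}\right)^v A^{1/2}$, with powers defined by the continuous functional calculus. $L(x,y)=\frac{y-x}{\log y-\log x}$ ($x\ne y$, $x,y>0$) is the logarithmic mean, and $S(t)=\frac{t^{1/(t-1)}}{e\log t^{1/(t-1)}}$ ($t>0$, $t\neq 1$) is Specht's ratio. *)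

theory Defs
  imports "HOL-Analysis.Analysis" "HOL-Computational_Algebra.Polynomial"
    "HOL-Library.Nonpos_Ints"
begin

text \<open>Complex Hilbert spaces. The inner product is linear in its first argument; definiteness
  follows from the norm axiom, completeness from \<^class>\<open>banach\<close>.\<close>

class complex_hilbert = banach +
  fixes scaleC :: "complex \<Rightarrow> 'a \<Rightarrow> 'a" (infixr \<open>*\<^sub>C\<close> 75)
    and cinner :: "'a \<Rightarrow> 'a \<Rightarrow> complex"
  assumes scaleC_add_right: "c *\<^sub>C (x + y) = c *\<^sub>C x + c *\<^sub>C y"
    and scaleC_add_left: "(c + d) *\<^sub>C x = c *\<^sub>C x + d *\<^sub>C x"
    and scaleC_scaleC: "c *\<^sub>C d *\<^sub>C x = (c * d) *\<^sub>C x"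
    and scaleC_one: "1 *\<^sub>C x = x"
    and scaleR_scaleC: "r *\<^sub>R x = complex_of_real r *\<^sub>C x"
    and cinner_commute: "cinner x y = cnj (cinner y x)"
    and cinner_add_left: "cinner (x + y) z = cinner x z + cinner y z"
    and cinner_scaleC_left: "cinner (c *\<^sub>C x) y = c * cinner x y"
    and cinner_self_nonneg: "cinner x x \<in> \<real>\<^sub>\<ge>\<^sub>0"
    and norm_eq_sqrt_cinner: "norm x = sqrt (Re (cinner x x))"

instantiation complex :: complex_hilbert
begin

definition scaleC_complex :: "complex \<Rightarrow> complex \<Rightarrow> complex"
  where "scaleC_complex c x = c * x"

definition cinner_complex :: "complex \<Rightarrow> complex \<Rightarrow> complex"
  where "cinner_complex x y = x * cnj y"

instance
  by standard
    (auto simp: scaleC_complex_def cinner_complex_def algebra_simps scaleR_conv_of_real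
      complex_nonneg_Reals_iff cmod_def power2_eq_square)

end

lemma norm_scaleC: "norm (c *\<^sub>C x) = cmod c * norm (x :: 'a::complex_hilbert)"
proof -
  have "cinner (c *\<^sub>C x) (c *\<^sub>C x) = c * cnj c * cinner x x"
    by (metis (no_types) cinner_commute cinner_scaleC_left complex_cnj_mult mult.assoc
        mult.left_commute)
  then have "Re (cinner (c *\<^sub>C x) (c *\<^sub>C x)) = (cmod c)\<^sup>2 * Re (cinner x x)"
    by (simp add: complex_mult_cnj cmod_power2 flip: of_real_power of_real_add)
  then show ?thesis
    by (simp add: norm_eq_sqrt_cinner[where 'a = 'a] real_sqrt_mult)
qed

lemma bounded_linear_scaleC: "bounded_linear (\<lambda>x::'a::complex_hilbert. c *\<^sub>C x)"
  by (rule bounded_linear_intro[where K = "cmod c"])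
    (simp_all add: scaleC_add_right scaleR_scaleC scaleC_scaleC mult.commute norm_scaleC)

text \<open>Operators are elements of \<open>'a \<Rightarrow>\<^sub>L 'a\<close>, whose bounded functions are only required to be
  real linear, subject to the following condition.\<close>

definition complex_linear :: "('a::complex_hilbert \<Rightarrow>\<^sub>L 'a) \<Rightarrow> bool"
  where "complex_linear A \<longleftrightarrow> (\<forall>c x. blinfun_apply A (c *\<^sub>C x) = c *\<^sub>C blinfun_apply A x)"

lift_definition scalar_op :: "complex \<Rightarrow> ('a::complex_hilbert \<Rightarrow>\<^sub>L 'a)"
  is "\<lambda>c x. c *\<^sub>C x"
  by (rule bounded_linear_scaleC)

text \<open>The inverse of a complex linear operator is automatically complex linear.\<close>

definition invertible_op :: "('a::complex_hilbert \<Rightarrow>\<^sub>L 'a) \<Rightarrow> bool"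
  where "invertible_op A \<longleftrightarrow> (\<exists>B. A o\<^sub>L B = id_blinfun \<and> B o\<^sub>L A = id_blinfun)"

definition positive_op :: "('a::complex_hilbert \<Rightarrow>\<^sub>L 'a) \<Rightarrow> bool"
  where "positive_op A \<longleftrightarrow> (\<forall>x. cinner (blinfun_apply A x) x \<in> \<real>\<^sub>\<ge>\<^sub>0)"

definition strictly_positive_op :: "('a::complex_hilbert \<Rightarrow>\<^sub>L 'a) \<Rightarrow> bool"
  where "strictly_positive_op A \<longleftrightarrow> positive_op A \<and> invertible_op A"

definition op_le :: "('a::complex_hilbert \<Rightarrow>\<^sub>L 'a) \<Rightarrow> ('a \<Rightarrow>\<^sub>L 'a) \<Rightarrow> bool" (infix \<open>\<le>\<^sub>o\<^sub>p\<close> 50)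
  where "A \<le>\<^sub>o\<^sub>p B \<longleftrightarrow> positive_op (B - A)"

definition spectrum :: "('a::complex_hilbert \<Rightarrow>\<^sub>L 'a) \<Rightarrow> complex set"
  where "spectrum A = {c. \<not> invertible_op (A - scalar_op c)}"

definition poly_op :: "real poly \<Rightarrow> ('a::complex_hilbert \<Rightarrow>\<^sub>L 'a) \<Rightarrow> ('a \<Rightarrow>\<^sub>L 'a)"
  where "poly_op p A = (\<Sum>i\<le>degree p. coeff p i *\<^sub>R (((o\<^sub>L) A) ^^ i) id_blinfun)"

text \<open>Continuous functional calculus of a self-adjoint operator \<open>A\<close>, for real functions \<open>f\<close>
  continuous on the spectrum (a compact subset of the reals): \<open>f(A)\<close> is the norm limit of
  \<open>p\<^sub>n(A)\<close> for any polynomials \<open>p\<^sub>n\<close> converging to \<open>f\<close> uniformly on the spectrum. For other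
  \<open>A\<close> or \<open>f\<close> the value is unspecified.\<close>

definition cfc :: "(real \<Rightarrow> real) \<Rightarrow> ('a::complex_hilbert \<Rightarrow>\<^sub>L 'a) \<Rightarrow> ('a \<Rightarrow>\<^sub>L 'a)"
  where "cfc f A = (THE T. \<forall>p :: nat \<Rightarrow> real poly.
    uniform_limit {t. complex_of_real t \<in> spectrum A} (\<lambda>n. poly (p n)) f sequentially
    \<longrightarrow> (\<lambda>n. poly_op (p n) A) \<longlonglongrightarrow> T)"

definition op_powr :: "('a::complex_hilbert \<Rightarrow>\<^sub>L 'a) \<Rightarrow> real \<Rightarrow> ('a \<Rightarrow>\<^sub>L 'a)"
  where "op_powr A v = cfc (\<lambda>t. t powr v) A"

definition arith_mean :: "real \<Rightarrow> ('a::complex_hilbert \<Rightarrow>\<^sub>L 'a) \<Rightarrow> ('a \<Rightarrow>\<^sub>L 'a) \<Rightarrow> ('a \<Rightarrow>\<^sub>L 'a)"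
  where "arith_mean v A B = (1 - v) *\<^sub>R A + v *\<^sub>R B"

definition geom_mean :: "real \<Rightarrow> ('a::complex_hilbert \<Rightarrow>\<^sub>L 'a) \<Rightarrow> ('a \<Rightarrow>\<^sub>L 'a) \<Rightarrow> ('a \<Rightarrow>\<^sub>L 'a)"
  where "geom_mean v A B =
    op_powr A (1/2) o\<^sub>L op_powr (op_powr A (-1/2) o\<^sub>L B o\<^sub>L op_powr A (-1/2)) v
      o\<^sub>L op_powr A (1/2)"

definition log_mean :: "real \<Rightarrow> real \<Rightarrow> real"
  where "log_mean x y = (y - x) / (ln y - ln x)"

definition specht_ratio :: "real \<Rightarrow> real"
  where "specht_ratio t = t powr (1 / (t - 1)) / (exp 1 * ln (t powr (1 / (t - 1))))"

definition g :: "real \<Rightarrow> real \<Rightarrow> real"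
  where "g v x = (1 - v) + v * x - x powr v"

end

theory Submission
  imports Defs "HOL-Computational_Algebra.Fundamental_Theorem_Algebra"
begin

text \<open>
  Put \<open>X = A\<^sup>1\<^sup>/\<^sup>2\<close>, \<open>Y = A\<^sup>-\<^sup>1\<^sup>/\<^sup>2\<close> and \<open>C = Y B Y\<close>. Then \<open>A = X X\<close>, \<open>B = X C X\<close>, and the weighted geometric
  mean is \<open>X C\<^sup>v X\<close>, so the difference of the two means is \<open>X g\<^sub>v(C) X\<close>. The bounds on \<open>A\<close> and \<open>B\<close> give
  \<open>1/h \<le> C \<le> h\<close>. As \<open>g\<^sub>v\<close> is convex, it is at most the larger of its two boundary values on
  \<open>[1/h, h]\<close> (\<open>g_le_max\<close>); by positivity of the functional calculus this bound passes to \<open>g\<^sub>v(C)\<close>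
  (\<open>positive_op_minus_g\<close>), and sandwiching with \<open>X\<close> yields the first inequality. The second one is
  scalar: maximizing \<open>g\<^sub>v(x)\<close> over \<open>v\<close> for fixed \<open>x\<close> gives exactly \<open>L(1, x) ln S(x)\<close>
  (\<open>g_le_log_mean_specht\<close>), and this bound is larger at \<open>x = h\<close> than at \<open>x = 1/h\<close>
  (\<open>max_g_le_log_mean_specht\<close>).

  The functional calculus is built from one estimate, \<open>\<parallel>p(A)\<parallel> \<le> sup \<bar>p\<bar>\<close> over the spectrum, for
  hermitian \<open>A\<close> and real polynomials \<open>p\<close> (\<open>norm_poly_op_le\<close>). It rests on two facts. First,
  \<open>\<parallel>S\<parallel>\<^sup>2 - S\<^sup>2\<close> is never invertible for hermitian \<open>S \<noteq> 0\<close> (\<open>hermitian_norm_not_invertible\<close>). Second, if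
  \<open>q(A)\<close> is not invertible for a real polynomial \<open>q \<noteq> 0\<close>, then \<open>q\<close> has a root in the spectrum
  (\<open>poly_op_not_invertible_root\<close>), because the quadratic factors of \<open>q\<close> without real roots give coercive, hence
  invertible, operators. With \<open>S = p(A)\<close> and \<open>q = \<parallel>S\<parallel>\<^sup>2 - p\<^sup>2\<close> the norm of \<open>p(A)\<close> is a value of
  \<open>\<bar>p\<bar>\<close> on the spectrum. Polynomial approximation then transfers sums, products and positivity from
  polynomials to continuous functions.
\<close>

section \<open>Hermitian operators\<close>

lemma cinner_scaleC_right: "cinner (x::'a::complex_hilbert) (c *\<^sub>C y) = cnj c * cinner x y"
  by (metis cinner_commute cinner_scaleC_left complex_cnj_mult)

lemma cinner_add_right: "cinner (x::'a::complex_hilbert) (y + z) = cinner x y + cinner x z"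
  by (metis cinner_add_left cinner_commute complex_cnj_add)

lemma cinner_scaleR_left: "cinner (r *\<^sub>R (x::'a::complex_hilbert)) y = of_real r * cinner x y"
  by (simp add: scaleR_scaleC cinner_scaleC_left)

lemma cinner_scaleR_right: "cinner (x::'a::complex_hilbert) (r *\<^sub>R y) = of_real r * cinner x y"
  by (simp add: scaleR_scaleC cinner_scaleC_right)

lemma cinner_minus_left: "cinner (- (x::'a::complex_hilbert)) y = - cinner x y"
  using cinner_scaleR_left[of "-1" x y] by simp

lemma cinner_minus_right: "cinner (x::'a::complex_hilbert) (- y) = - cinner x y"
  using cinner_scaleR_right[of x "-1" y] by simp

lemma cinner_diff_left: "cinner ((x::'a::complex_hilbert) - y) z = cinner x z - cinner y z"
  using cinner_add_left[of x "- y" z] by (simp add: cinner_minus_left)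

lemma cinner_diff_right: "cinner (x::'a::complex_hilbert) (y - z) = cinner x y - cinner x z"
  using cinner_add_right[of x y "- z"] by (simp add: cinner_minus_right)

lemma cinner_self_ge_0: "0 \<le> Re (cinner (x::'a::complex_hilbert) x)"
  using cinner_self_nonneg[of x] by (simp add: complex_nonneg_Reals_iff)

lemma power2_norm_eq_cinner: "(norm (x::'a::complex_hilbert))\<^sup>2 = Re (cinner x x)"
  by (simp add: norm_eq_sqrt_cinner[where 'a='a] cinner_self_ge_0)

lemma Re_cinner_commute: "Re (cinner (x::'a::complex_hilbert) y) = Re (cinner y x)"
  by (metis cinner_commute complex_cnj(1) cnj.simps(1))

lemma norm_diff_squared:
  "(norm ((x::'a::complex_hilbert) - y))\<^sup>2 = (norm x)\<^sup>2 - 2 * Re (cinner x y) + (norm y)\<^sup>2"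
  using Re_cinner_commute[of x y]
  by (simp add: power2_norm_eq_cinner cinner_diff_left cinner_diff_right)

lemma Re_cinner_polar:
  "Re (cinner (x::'a::complex_hilbert) y) = ((norm x)\<^sup>2 + (norm y)\<^sup>2 - (norm (x - y))\<^sup>2) / 2"
  by (simp add: norm_diff_squared)

lemma cinner_polar:
  "cinner (x::'a::complex_hilbert) y = Complex (Re (cinner x y)) (Re (cinner x (\<i> *\<^sub>C y)))"
  by (simp add: complex_eq_iff cinner_scaleC_right)

text \<open>Polarization expresses the inner product through norms, so continuity comes without the
  Cauchy--Schwarz inequality.\<close>

lemma tendsto_cinner_left:
  assumes "(f \<longlongrightarrow> (x::'a::complex_hilbert)) F"
  shows "((\<lambda>n. cinner (f n) y) \<longlongrightarrow> cinner x y) F"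
proof -
  have "((\<lambda>n. Re (cinner (f n) z)) \<longlongrightarrow> Re (cinner x z)) F" for z
    unfolding Re_cinner_polar by (intro tendsto_intros assms) simp
  then show ?thesis
    by (subst cinner_polar, subst (2) cinner_polar) (intro tendsto_Complex)
qed

definition hermitian :: "('a::complex_hilbert \<Rightarrow>\<^sub>L 'a) \<Rightarrow> bool"
  where "hermitian T \<longleftrightarrow> (\<forall>x y. cinner (T x) y = cinner x (T y))"

lemma hermitianD: "hermitian T \<Longrightarrow> cinner (T x) y = cinner x (T y)"
  by (simp add: hermitian_def)

lemma hermitian_cinner_real: "hermitian T \<Longrightarrow> cinner (T x) x \<in> \<real>"
  by (metis cinner_commute hermitianD Reals_cnj_iff)

lemma positive_op_iff_hermitian:
  "hermitian T \<Longrightarrow> positive_op T \<longleftrightarrow> (\<forall>x. 0 \<le> Re (cinner (T x) x))"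
  using hermitian_cinner_real[of T]
  by (auto simp: positive_op_def complex_nonneg_Reals_iff complex_is_Real_iff)

text \<open>Over the complex numbers a sesquilinear form that vanishes on the diagonal is zero. Here the
  form is \<open>\<langle>Tx, y\<rangle> - \<langle>x, Ty\<rangle>\<close>.\<close>

lemma positive_op_imp_hermitian:
  assumes lin: "complex_linear T" and pos: "positive_op T"
  shows "hermitian T"
proof -
  define s where "s x y = cinner (T x) y - cinner x (T y)" for x y
  have s_self: "s x x = 0" for x
  proof -
    have "Im (cinner (T x) x) = 0"
      using pos by (simp add: positive_op_def complex_nonneg_Reals_iff)
    then show ?thesis
      unfolding s_def using cinner_commute[of x "T x"] by (simp add: complex_eq_iff)
  qed
  have s_add: "s (x + y) (x + y) = s x x + s x y + s y x + s y y" for x y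
    by (simp add: s_def blinfun.add_right cinner_add_left cinner_add_right)
  have anti: "s x y + s y x = 0" for x y
    using s_add[of x y] s_self by simp
  have sc: "s x (\<i> *\<^sub>C y) = - \<i> * s x y" "s (\<i> *\<^sub>C y) x = \<i> * s y x" for x y
    using lin
    by (simp_all add: s_def complex_linear_def cinner_scaleC_left cinner_scaleC_right algebra_simps)
  have "s x y = 0" for x y
  proof -
    have "\<i> * (s y x - s x y) = 0"
      using anti[of x "\<i> *\<^sub>C y"] by (simp add: sc algebra_simps)
    then have "s y x = s x y" by simp
    then show ?thesis using anti[of x y] by simp
  qed
  then show ?thesis by (simp add: hermitian_def s_def)
qed

lemma hermitian_add: "hermitian S \<Longrightarrow> hermitian T \<Longrightarrow> hermitian (S + T)"
  by (simp add: hermitian_def blinfun.add_left cinner_add_left cinner_add_right)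

lemma hermitian_diff: "hermitian S \<Longrightarrow> hermitian T \<Longrightarrow> hermitian (S - T)"
  by (simp add: hermitian_def blinfun.diff_left cinner_diff_left cinner_diff_right)

lemma hermitian_scaleR: "hermitian T \<Longrightarrow> hermitian (r *\<^sub>R T)"
  by (simp add: hermitian_def blinfun.scaleR_left cinner_scaleR_left cinner_scaleR_right)

lemma hermitian_id: "hermitian id_blinfun"
  by (simp add: hermitian_def)

lemma hermitian_commute_compose:
  "hermitian S \<Longrightarrow> hermitian T \<Longrightarrow> S o\<^sub>L T = T o\<^sub>L S \<Longrightarrow> hermitian (S o\<^sub>L T)"
  by (metis blinfun_apply_blinfun_compose hermitian_def)

lemma hermitian_sandwich:
  "hermitian S \<Longrightarrow> hermitian T \<Longrightarrow> hermitian (S o\<^sub>L T o\<^sub>L S)"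
  by (simp add: hermitian_def)

lemma tendsto_cinner_blinfun:
  "T \<longlonglongrightarrow> S \<Longrightarrow> (\<lambda>n. cinner (blinfun_apply (T n) x) y) \<longlonglongrightarrow> cinner (S x) y"
  by (intro tendsto_cinner_left tendsto_intros)

lemma hermitian_limit:
  assumes "\<And>n. hermitian (T n)" and "T \<longlonglongrightarrow> S"
  shows "hermitian S"
  unfolding hermitian_def
proof (intro allI)
  fix x y
  have "(\<lambda>n. cinner (T n x) y) \<longlonglongrightarrow> cnj (cinner (S y) x)"
    using tendsto_cnj[OF tendsto_cinner_blinfun[OF assms(2), of y x]]
    using assms(1) by (simp add: hermitianD cinner_commute[symmetric])
  then show "cinner (S x) y = cinner x (S y)"
    using LIMSEQ_unique[OF tendsto_cinner_blinfun[OF assms(2), of x y]]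
    by (simp add: cinner_commute[symmetric])
qed

lemma positive_op_sandwich:
  "hermitian S \<Longrightarrow> positive_op T \<Longrightarrow> positive_op (S o\<^sub>L T o\<^sub>L S)"
  by (simp add: positive_op_def hermitianD)

section \<open>Invertibility\<close>

lemma blinfun_compose_id [simp]: "id_blinfun o\<^sub>L T = T" "T o\<^sub>L id_blinfun = T"
  by (simp_all add: blinfun_eqI)

lemma blinfun_compose_assoc: "(R o\<^sub>L S) o\<^sub>L T = R o\<^sub>L (S o\<^sub>L T)"
  by (simp add: blinfun_eqI)

lemma invertible_op_compose:
  assumes "invertible_op S" and "invertible_op T"
  shows "invertible_op (S o\<^sub>L T)"
proof -
  obtain S' T' where "S o\<^sub>L S' = id_blinfun" "S' o\<^sub>L S = id_blinfun"
      "T o\<^sub>L T' = id_blinfun" "T' o\<^sub>L T = id_blinfun"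
    using assms by (auto simp: invertible_op_def)
  then have "(S o\<^sub>L T) o\<^sub>L (T' o\<^sub>L S') = id_blinfun" "(T' o\<^sub>L S') o\<^sub>L (S o\<^sub>L T) = id_blinfun"
    by (metis blinfun_compose_assoc blinfun_compose_id(1))+
  then show ?thesis unfolding invertible_op_def by blast
qed

lemma invertible_op_id: "invertible_op id_blinfun"
  unfolding invertible_op_def by (intro exI[of _ id_blinfun]) simp

lemma invertible_op_scaleR:
  assumes "invertible_op T" and "r \<noteq> 0"
  shows "invertible_op (r *\<^sub>R T)"
proof -
  obtain S where S: "T o\<^sub>L S = id_blinfun" "S o\<^sub>L T = id_blinfun"
    using assms by (auto simp: invertible_op_def)
  have "T (S x) = x" "S (T x) = x" for x
    using S by (metis blinfun_apply_blinfun_compose blinfun_apply_id_blinfun)+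
  then have "(r *\<^sub>R T) o\<^sub>L ((1/r) *\<^sub>R S) = id_blinfun" "((1/r) *\<^sub>R S) o\<^sub>L (r *\<^sub>R T) = id_blinfun"
    using assms(2)
    by (auto intro!: blinfun_eqI simp: blinfun.scaleR_left blinfun.scaleR_right)
  then show ?thesis unfolding invertible_op_def by blast
qed

text \<open>For \<open>\<tau> = d / L\<^sup>2\<close> with \<open>L \<ge> \<parallel>P\<parallel>\<close> one has
  \<open>\<parallel>x - \<tau> P x\<parallel>\<^sup>2 \<le> (1 - 2 \<tau> d + \<tau>\<^sup>2 L\<^sup>2) \<parallel>x\<parallel>\<^sup>2 = (1 - d\<^sup>2 / L\<^sup>2) \<parallel>x\<parallel>\<^sup>2\<close>, so solving
  \<open>P x = y\<close> amounts to finding the fixed point of a contraction.\<close>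

lemma invertible_op_coercive:
  fixes P :: "'a::complex_hilbert \<Rightarrow>\<^sub>L 'a"
  assumes "0 < d" and coercive: "\<And>x. d * (norm x)\<^sup>2 \<le> Re (cinner (P x) x)"
  shows "invertible_op P"
proof -
  define L where "L = norm P + d"
  define \<tau> where "\<tau> = d / L\<^sup>2"
  define k where "k = sqrt (1 - d\<^sup>2 / L\<^sup>2)"
  have L: "0 < L" "d \<le> L" "norm P \<le> L" using \<open>0 < d\<close> by (auto simp: L_def add_nonneg_pos)
  have \<tau>: "0 < \<tau>" using L \<open>0 < d\<close> by (simp add: \<tau>_def)
  have "d\<^sup>2 / L\<^sup>2 \<le> 1" "0 < d\<^sup>2 / L\<^sup>2" using L \<open>0 < d\<close> by (simp_all add: power_mono)
  then have k: "0 \<le> k" "k < 1" "k\<^sup>2 = 1 - d\<^sup>2 / L\<^sup>2" by (simp_all add: k_def)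
  have contr: "norm (x - \<tau> *\<^sub>R P x) \<le> k * norm x" for x
  proof -
    have "norm (P x) \<le> L * norm x"
      using norm_blinfun[of P x] L by (meson mult_right_mono norm_ge_zero order_trans)
    then have Px: "(norm (P x))\<^sup>2 \<le> L\<^sup>2 * (norm x)\<^sup>2"
      by (metis norm_ge_zero power_mono power_mult_distrib)
    have "(norm (x - \<tau> *\<^sub>R P x))\<^sup>2
        = (norm x)\<^sup>2 - 2 * \<tau> * Re (cinner (P x) x) + \<tau>\<^sup>2 * (norm (P x))\<^sup>2"
      using Re_cinner_commute[of x "P x"]
      by (simp add: norm_diff_squared cinner_scaleR_right power_mult_distrib)
    also have "\<dots> \<le> (norm x)\<^sup>2 - 2 * \<tau> * (d * (norm x)\<^sup>2) + \<tau>\<^sup>2 * (L\<^sup>2 * (norm x)\<^sup>2)"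
      using coercive[of x] Px \<tau> by (intro add_mono diff_mono mult_left_mono) auto
    also have "\<dots> = (1 - 2 * \<tau> * d + \<tau>\<^sup>2 * L\<^sup>2) * (norm x)\<^sup>2"
      by (simp add: algebra_simps)
    also have "1 - 2 * \<tau> * d + \<tau>\<^sup>2 * L\<^sup>2 = k\<^sup>2"
      unfolding k(3) \<tau>_def using L by (simp add: field_simps power2_eq_square)
    finally show ?thesis
      using k(1) by (metis abs_le_square_iff abs_of_nonneg mult_nonneg_nonneg norm_ge_zero power_mult_distrib)
  qed
  have ex1: "\<exists>!x. P x = y" for y
  proof -
    have "\<exists>!x. x - \<tau> *\<^sub>R P x + \<tau> *\<^sub>R y = x"
    proof (rule banach_fix_type[OF k(1,2)], intro allI)
      fix u w
      show "dist (u - \<tau> *\<^sub>R P u + \<tau> *\<^sub>R y) (w - \<tau> *\<^sub>R P w + \<tau> *\<^sub>R y) \<le> k * dist u w"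
        using contr[of "u - w"] by (simp add: dist_norm blinfun.diff_right algebra_simps)
    qed
    moreover have "x - \<tau> *\<^sub>R P x + \<tau> *\<^sub>R y = x \<longleftrightarrow> P x = y" for x
      using \<tau> by (auto simp: algebra_simps)
    ultimately show ?thesis by simp
  qed
  define R where "R y = (THE x. P x = y)" for y
  have PR: "P (R y) = y" for y unfolding R_def by (rule theI'[OF ex1])
  have RP: "R (P x) = x" for x using ex1 PR by metis
  have bound: "norm (R y) \<le> norm y * (\<tau> / (1 - k))" for y
  proof -
    have "norm (R y) \<le> norm (R y - \<tau> *\<^sub>R P (R y)) + norm (\<tau> *\<^sub>R P (R y))"
      by (metis diff_add_cancel norm_triangle_ineq)
    also have "\<dots> \<le> k * norm (R y) + \<tau> * norm y"
      using contr[of "R y"] \<tau> by (simp add: PR)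
    finally have "(1 - k) * norm (R y) \<le> \<tau> * norm y" by (simp add: algebra_simps)
    then show ?thesis using k by (simp add: field_simps)
  qed
  have "bounded_linear R"
  proof (rule bounded_linear_intro[OF _ _ bound])
    show "R (x + y) = R x + R y" for x y by (metis PR RP blinfun.add_right)
    show "R (r *\<^sub>R x) = r *\<^sub>R R x" for r x by (metis PR RP blinfun.scaleR_right)
  qed
  then have "P o\<^sub>L Blinfun R = id_blinfun" "Blinfun R o\<^sub>L P = id_blinfun"
    by (auto intro!: blinfun_eqI simp: bounded_linear_Blinfun_apply PR RP)
  then show ?thesis unfolding invertible_op_def by blast
qed

lemma invertible_op_uminus: "invertible_op (- T) \<Longrightarrow> invertible_op T"
  using invertible_op_scaleR[of "- T" "-1"] by simp

section \<open>Polynomials of an operator and its real spectrum\<close>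

text \<open>The set on which the functional calculus of \<open>A\<close> asks for uniform convergence.\<close>

definition real_spectrum :: "('a::complex_hilbert \<Rightarrow>\<^sub>L 'a) \<Rightarrow> real set"
  where "real_spectrum A = {t. complex_of_real t \<in> spectrum A}"

lemma real_spectrum_iff: "t \<in> real_spectrum A \<longleftrightarrow> \<not> invertible_op (A - t *\<^sub>R id_blinfun)"
proof -
  have "scalar_op (complex_of_real t) = (t *\<^sub>R id_blinfun :: 'a \<Rightarrow>\<^sub>L 'a)"
    by (intro blinfun_eqI) (simp add: scalar_op.rep_eq blinfun.scaleR_left scaleR_scaleC)
  then show ?thesis by (simp add: real_spectrum_def spectrum_def)
qed

lemma real_spectrum_subset:
  fixes A :: "'a::complex_hilbert \<Rightarrow>\<^sub>L 'a"
  assumes lower: "\<And>x. a * (norm x)\<^sup>2 \<le> Re (cinner (A x) x)"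
    and upper: "\<And>x. Re (cinner (A x) x) \<le> b * (norm x)\<^sup>2"
  shows "real_spectrum A \<subseteq> {a..b}"
proof
  fix t assume t: "t \<in> real_spectrum A"
  have val: "Re (cinner ((A - t *\<^sub>R id_blinfun) x) x) = Re (cinner (A x) x) - t * (norm x)\<^sup>2" for x
    by (simp add: blinfun.diff_left blinfun.scaleR_left cinner_diff_left cinner_scaleR_left
        power2_norm_eq_cinner)
  have "a \<le> t"
  proof (rule ccontr)
    assume "\<not> a \<le> t"
    then have "invertible_op (A - t *\<^sub>R id_blinfun)"
      using lower by (intro invertible_op_coercive[of "a - t"]) (auto simp: val algebra_simps)
    then show False using t by (simp add: real_spectrum_iff)
  qed
  moreover have "t \<le> b"
  proof (rule ccontr)
    assume "\<not> t \<le> b"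
    moreover have "(t - b) * (norm x)\<^sup>2
        \<le> Re (cinner ((- (A - t *\<^sub>R id_blinfun)) x) x)" for x
      using upper[of x]
      by (simp add: val blinfun.minus_left cinner_minus_left left_diff_distrib del: minus_diff_eq)
    ultimately have "invertible_op (- (A - t *\<^sub>R id_blinfun))"
      by (intro invertible_op_coercive[of "t - b"]) auto
    then show False using t invertible_op_uminus real_spectrum_iff by blast
  qed
  ultimately show "t \<in> {a..b}" by simp
qed

lemma poly_op_eq_sum:
  assumes "degree p \<le> n"
  shows "poly_op p A = (\<Sum>i\<le>n. coeff p i *\<^sub>R (((o\<^sub>L) A) ^^ i) id_blinfun)"
  unfolding poly_op_def
  by (rule sum.mono_neutral_left) (use assms in \<open>auto simp: coeff_eq_0\<close>)

lemma poly_op_add: "poly_op (p + q) A = poly_op p A + poly_op q A"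
proof -
  let ?n = "max (degree p) (degree q)"
  have "degree (p + q) \<le> ?n" "degree p \<le> ?n" "degree q \<le> ?n"
    by (auto intro: degree_add_le_max)
  then show ?thesis
    by (simp add: poly_op_eq_sum[where n = ?n] scaleR_add_left sum.distrib)
qed

lemma poly_op_smult: "poly_op (smult c p) A = c *\<^sub>R poly_op p A"
proof -
  have "degree (smult c p) \<le> degree p" by (rule degree_smult_le)
  then show ?thesis
    by (simp add: poly_op_eq_sum[where n = "degree p"] scaleR_sum_right)
qed

lemma poly_op_diff: "poly_op (p - q) A = poly_op p A - poly_op q A"
  using poly_op_add[of p "smult (-1) q" A] poly_op_smult[of "-1" q A] by simp

lemma poly_op_0 [simp]: "poly_op 0 A = 0"
  by (simp add: poly_op_def)

lemma blinfun_compose_linear: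
  "A o\<^sub>L (S + T) = (A o\<^sub>L S) + (A o\<^sub>L T)" "(S + T) o\<^sub>L A = (S o\<^sub>L A) + (T o\<^sub>L A)"
  "A o\<^sub>L (S - T) = (A o\<^sub>L S) - (A o\<^sub>L T)" "(S - T) o\<^sub>L A = (S o\<^sub>L A) - (T o\<^sub>L A)"
  "A o\<^sub>L (c *\<^sub>R S) = c *\<^sub>R (A o\<^sub>L S)" "(c *\<^sub>R S) o\<^sub>L A = c *\<^sub>R (S o\<^sub>L A)"
  by (auto intro!: blinfun_eqI simp: blinfun.add_left blinfun.add_right blinfun.diff_left
      blinfun.diff_right blinfun.scaleR_left blinfun.scaleR_right)

lemma poly_op_pCons: "poly_op (pCons a p) A = a *\<^sub>R id_blinfun + (A o\<^sub>L poly_op p A)"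
proof -
  have comp_sum: "A o\<^sub>L (\<Sum>i\<le>n. f i) = (\<Sum>i\<le>n. A o\<^sub>L f i)" for f :: "nat \<Rightarrow> 'a \<Rightarrow>\<^sub>L 'a" and n
    by (induction n) (simp_all add: blinfun_compose_linear)
  have "poly_op (pCons a p) A
      = (\<Sum>i\<le>Suc (degree p). coeff (pCons a p) i *\<^sub>R (((o\<^sub>L) A) ^^ i) id_blinfun)"
    by (rule poly_op_eq_sum) (rule degree_pCons_le)
  also have "\<dots> = a *\<^sub>R id_blinfun + (\<Sum>i\<le>degree p. coeff p i *\<^sub>R (((o\<^sub>L) A) ^^ Suc i) id_blinfun)"
    by (subst sum.atMost_Suc_shift) simp
  finally show ?thesis by (simp add: comp_sum blinfun_compose_linear poly_op_def)
qed

lemma poly_op_const: "poly_op [:c:] A = c *\<^sub>R id_blinfun"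
  by (simp add: poly_op_pCons)

lemma poly_op_linear: "poly_op [:c, d:] A = c *\<^sub>R id_blinfun + d *\<^sub>R A"
  by (simp add: poly_op_pCons blinfun_compose_linear)

lemma poly_op_mult: "poly_op (p * q) A = poly_op p A o\<^sub>L poly_op q A"
proof (induction p)
  case (pCons a p)
  have "poly_op (pCons a p * q) A
      = a *\<^sub>R poly_op q A + (A o\<^sub>L (poly_op p A o\<^sub>L poly_op q A))"
    using pCons by (simp add: poly_op_add poly_op_smult poly_op_pCons)
  also have "\<dots> = poly_op (pCons a p) A o\<^sub>L poly_op q A"
    by (simp add: poly_op_pCons blinfun_compose_linear blinfun_compose_assoc)
  finally show ?case .
qed simp

lemma hermitian_poly_op:
  assumes "hermitian A"
  shows "hermitian (poly_op p A)"
proof (induction p)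
  case (pCons a p)
  have "A o\<^sub>L poly_op p A = poly_op p A o\<^sub>L A"
    using poly_op_mult[of "[:0, 1:]" p A] poly_op_mult[of p "[:0, 1:]" A]
    by (simp add: mult.commute poly_op_linear)
  then show ?case
    by (auto simp: poly_op_pCons intro!: hermitian_add hermitian_scaleR hermitian_id
        hermitian_commute_compose assms pCons)
qed (use hermitian_scaleR[OF hermitian_id, of 0] in simp)

lemma poly_of_real_add:
  "poly (map_poly of_real (p + q)) (z::complex)
    = poly (map_poly of_real p) z + poly (map_poly of_real q) z"
  by (induction p q rule: poly_induct2) (simp_all add: map_poly_pCons algebra_simps)

lemma poly_of_real_mult:
  "poly (map_poly of_real (p * q)) (z::complex)
    = poly (map_poly of_real p) z * poly (map_poly of_real q) z"
proof -
  have smult: "poly (map_poly of_real (smult c p)) z = of_real c * poly (map_poly of_real p) z" for c p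
    by (induction p) (simp_all add: map_poly_pCons algebra_simps)
  show ?thesis
    by (induction p) (simp_all add: map_poly_pCons poly_of_real_add smult algebra_simps)
qed

text \<open>The quadratic factor is \<open>(X - a)\<^sup>2 + b\<^sup>2\<close> for a nonreal complex root \<open>a + b\<i>\<close>: the remainder of
  \<open>q\<close> modulo it is a real polynomial \<open>c + d X\<close> that vanishes at a nonreal point, hence is zero.\<close>

lemma real_poly_factor:
  fixes q :: "real poly"
  assumes "degree q \<noteq> 0"
  obtains (linear) t r where "q = [:- t, 1:] * r"
    | (quadratic) a b r where "b \<noteq> 0" and "q = [:a\<^sup>2 + b\<^sup>2, - 2 * a, 1:] * r"
proof -
  let ?c = "map_poly of_real :: real poly \<Rightarrow> complex poly"
  have "degree (?c q) = degree q" by (simp add: degree_map_poly)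
  then have "\<not> constant (poly (?c q))" using assms by (simp add: constant_degree)
  then obtain z where z: "poly (?c q) z = 0" using fundamental_theorem_of_algebra by blast
  show ?thesis
  proof (cases "Im z = 0")
    case True
    have ev: "poly (?c p) (of_real x) = of_real (poly p x)" for p x
      by (induction p) (simp_all add: map_poly_pCons)
    have "z = of_real (Re z)" using True by (simp add: complex_eq_iff)
    then have "poly q (Re z) = 0" using z ev[of q "Re z"] by simp
    then show ?thesis using linear by (metis dvd_def poly_eq_0_iff_dvd)
  next
    case False
    define a b where "a = Re z" and "b = Im z"
    define s where "s = [:a\<^sup>2 + b\<^sup>2, - 2 * a, 1:]"
    have "degree (q mod s) < degree s \<or> q mod s = 0"
      using degree_mod_less[of s q] by (auto simp: s_def)
    then have "degree (q mod s) \<le> 1" by (auto simp: s_def)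
    moreover obtain c p where c: "q mod s = pCons c p" by (rule pCons_cases)
    ultimately have "degree p = 0" by (auto split: if_splits)
    then obtain d where "p = [:d:]" by (rule degree_eq_zeroE)
    then have cd: "q mod s = [:c, d:]" using c by simp
    have "poly (?c s) z = 0"
      by (simp add: s_def map_poly_pCons a_def b_def complex_eq_iff power2_eq_square algebra_simps)
    moreover have "poly (?c q) z = poly (?c s) z * poly (?c (q div s)) z + poly (?c (q mod s)) z"
      by (metis mult_div_mod_eq poly_of_real_add poly_of_real_mult)
    ultimately have "of_real c + of_real d * z = 0"
      using z by (simp add: cd map_poly_pCons mult.commute)
    then have "d = 0" "c = 0" using False by (auto simp: complex_eq_iff)
    then have "q mod s = 0" by (simp add: cd)
    then have "q = s * (q div s)" using mult_div_mod_eq[of s q] by simp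
    moreover have "b \<noteq> 0" using False by (simp add: b_def)
    ultimately show ?thesis using quadratic unfolding s_def by blast
  qed
qed

text \<open>Factor by factor: \<open>(A - a)\<^sup>2 + b\<^sup>2\<close> with \<open>b \<noteq> 0\<close> is coercive for hermitian \<open>A\<close>, so
  invertibility of \<open>q(A)\<close> can only fail at a linear factor. This is the spectral mapping
  theorem in the direction that bounds \<open>p(A)\<close> by values of \<open>p\<close>.\<close>

lemma poly_op_not_invertible_root:
  assumes A: "hermitian A" and "q \<noteq> 0" and "\<not> invertible_op (poly_op q A)"
  shows "\<exists>t\<in>real_spectrum A. poly q t = 0"
  using assms(2,3)
proof (induction "degree q" arbitrary: q rule: less_induct)
  case less
  show ?case
  proof (cases "degree q = 0")
    case True
    then obtain c where "q = [:c:]" by (rule degree_eq_zeroE)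
    then have False
      using less.prems invertible_op_scaleR[OF invertible_op_id, of c] by (auto simp: poly_op_const)
    then show ?thesis ..
  next
    case False
    then show ?thesis
    proof (cases rule: real_poly_factor)
      case (linear t r)
      have "r \<noteq> 0" using linear less.prems by auto
      then have deg: "degree r < degree q"
        unfolding linear by (subst degree_mult_eq) auto
      have eq: "poly_op q A = (A - t *\<^sub>R id_blinfun) o\<^sub>L poly_op r A"
        unfolding linear poly_op_mult by (simp add: poly_op_linear)
      show ?thesis
      proof (cases "t \<in> real_spectrum A")
        case True
        then show ?thesis by (intro bexI[of _ t]) (simp_all add: linear)
      next
        case False
        then have "\<not> invertible_op (poly_op r A)"
          using less.prems invertible_op_compose unfolding eq real_spectrum_iff by blast
        then show ?thesis
          using less.hyps[OF deg \<open>r \<noteq> 0\<close>] by (auto simp: linear)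
      qed
    next
      case (quadratic a b r)
      have "r \<noteq> 0" using quadratic less.prems by auto
      then have deg: "degree r < degree q"
        unfolding quadratic by (subst degree_mult_eq) auto
      define D where "D = A - a *\<^sub>R id_blinfun"
      have "hermitian D"
        unfolding D_def by (intro hermitian_diff hermitian_scaleR hermitian_id A)
      have "[:a\<^sup>2 + b\<^sup>2, - 2 * a, 1:] = [:- a, 1:] * [:- a, 1:] + [:b\<^sup>2:]"
        by (simp add: power2_eq_square)
      then have eq: "poly_op q A = ((D o\<^sub>L D) + b\<^sup>2 *\<^sub>R id_blinfun) o\<^sub>L poly_op r A"
        unfolding quadratic poly_op_mult
        by (simp only: poly_op_add poly_op_mult poly_op_linear poly_op_const) (simp add: D_def)
      have "invertible_op ((D o\<^sub>L D) + b\<^sup>2 *\<^sub>R id_blinfun)"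
      proof (rule invertible_op_coercive[of "b\<^sup>2"])
        show "0 < b\<^sup>2" using quadratic by simp
        show "b\<^sup>2 * (norm x)\<^sup>2 \<le> Re (cinner (((D o\<^sub>L D) + b\<^sup>2 *\<^sub>R id_blinfun) x) x)" for x
          using hermitianD[OF \<open>hermitian D\<close>, of "D x" x] cinner_self_ge_0[of "D x"]
          by (simp add: blinfun.add_left blinfun.scaleR_left cinner_add_left cinner_scaleR_left
              power2_norm_eq_cinner)
      qed
      then have "\<not> invertible_op (poly_op r A)"
        using less.prems invertible_op_compose unfolding eq by blast
      then show ?thesis
        using less.hyps[OF deg \<open>r \<noteq> 0\<close>] by (metis quadratic(2) poly_mult mult_zero_right)
    qed
  qed
qed

text \<open>With \<open>\<lambda> = \<parallel>S\<parallel>\<close> and \<open>\<parallel>S\<^sup>2 x\<parallel> \<le> \<lambda> \<parallel>S x\<parallel>\<close>, expanding the square gives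
  \<open>\<parallel>(\<lambda>\<^sup>2 - S\<^sup>2) x\<parallel>\<^sup>2 \<le> \<lambda>\<^sup>2 (\<lambda>\<^sup>2 \<parallel>x\<parallel>\<^sup>2 - \<parallel>S x\<parallel>\<^sup>2)\<close>. If \<open>\<lambda>\<^sup>2 - S\<^sup>2\<close> had a bounded inverse, this would keep
  \<open>\<parallel>S x\<parallel> / \<parallel>x\<parallel>\<close> away from its supremum \<open>\<lambda>\<close>.\<close>

lemma hermitian_norm_not_invertible:
  fixes S :: "'a::complex_hilbert \<Rightarrow>\<^sub>L 'a"
  assumes "hermitian S" and "S \<noteq> 0"
  shows "\<not> invertible_op ((norm S)\<^sup>2 *\<^sub>R id_blinfun - (S o\<^sub>L S))"
proof
  define l where "l = norm S"
  define T where "T = l\<^sup>2 *\<^sub>R id_blinfun - (S o\<^sub>L S)"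
  have "0 < l" using \<open>S \<noteq> 0\<close> by (simp add: l_def)
  assume "invertible_op ((norm S)\<^sup>2 *\<^sub>R id_blinfun - (S o\<^sub>L S))"
  then obtain R where R: "R o\<^sub>L T = id_blinfun"
    by (auto simp: invertible_op_def T_def l_def)
  define K where "K = (norm R)\<^sup>2 + 1"
  have "0 < K" by (simp add: K_def add_nonneg_pos)
  define d where "d = 1 / (K * l\<^sup>2)"
  have "0 < d" using \<open>0 < K\<close> \<open>0 < l\<close> by (simp add: d_def)
  have bound: "(norm (S x))\<^sup>2 \<le> (l\<^sup>2 - d) * (norm x)\<^sup>2" for x
  proof -
    have "norm (S (S x)) \<le> l * norm (S x)" unfolding l_def by (rule norm_blinfun)
    then have SS: "(norm (S (S x)))\<^sup>2 \<le> l\<^sup>2 * (norm (S x))\<^sup>2"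
      by (metis norm_ge_zero power_mono power_mult_distrib)
    have "Re (cinner x (S (S x))) = (norm (S x))\<^sup>2"
      using hermitianD[OF assms(1), of x "S x"] by (simp add: power2_norm_eq_cinner)
    then have "(norm (T x))\<^sup>2 = (l\<^sup>2 * norm x)\<^sup>2 - 2 * l\<^sup>2 * (norm (S x))\<^sup>2 + (norm (S (S x)))\<^sup>2"
      by (simp add: T_def blinfun.diff_left blinfun.scaleR_left norm_diff_squared
          cinner_scaleR_left power_mult_distrib flip: of_real_power)
    then have Tx: "(norm (T x))\<^sup>2 \<le> l\<^sup>2 * (l\<^sup>2 * (norm x)\<^sup>2 - (norm (S x))\<^sup>2)"
      using SS by (simp add: power2_eq_square algebra_simps)
    have "x = R (T x)" using R by (metis blinfun_apply_blinfun_compose blinfun_apply_id_blinfun)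
    then have "norm x \<le> norm R * norm (T x)" by (metis norm_blinfun)
    then have "(norm x)\<^sup>2 \<le> (norm R)\<^sup>2 * (norm (T x))\<^sup>2"
      by (metis norm_ge_zero power_mono power_mult_distrib)
    also have "\<dots> \<le> K * (norm (T x))\<^sup>2" by (simp add: K_def algebra_simps)
    also have "\<dots> \<le> K * (l\<^sup>2 * (l\<^sup>2 * (norm x)\<^sup>2 - (norm (S x))\<^sup>2))"
      using Tx \<open>0 < K\<close> by (intro mult_left_mono) auto
    finally have "d * (norm x)\<^sup>2 \<le> l\<^sup>2 * (norm x)\<^sup>2 - (norm (S x))\<^sup>2"
      using \<open>0 < K\<close> \<open>0 < l\<close> by (simp add: d_def field_simps)
    then show ?thesis by (simp add: algebra_simps)
  qed
  have "0 \<le> l\<^sup>2 - d"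
  proof -
    obtain x where "S x \<noteq> 0" using \<open>S \<noteq> 0\<close> by (metis blinfun_eqI blinfun.zero_left)
    then have "0 < (norm (S x))\<^sup>2" by simp
    then have "0 < (l\<^sup>2 - d) * (norm x)\<^sup>2" using bound[of x] by linarith
    then show ?thesis by (auto simp: zero_less_mult_iff)
  qed
  have "norm (S x) \<le> sqrt (l\<^sup>2 - d) * norm x" for x
    using real_sqrt_le_mono[OF bound[of x]] by (simp add: real_sqrt_mult)
  then have "l \<le> sqrt (l\<^sup>2 - d)"
    unfolding l_def by (intro norm_blinfun_bound) (use \<open>0 \<le> l\<^sup>2 - d\<close> in \<open>auto simp: l_def\<close>)
  then have "l\<^sup>2 \<le> l\<^sup>2 - d" using \<open>0 < l\<close> \<open>0 \<le> l\<^sup>2 - d\<close>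
    by (metis less_imp_le power_mono real_sqrt_pow2)
  then show False using \<open>0 < d\<close> by simp
qed

text \<open>The root lemma is applied to \<open>q = \<parallel>p(A)\<parallel>\<^sup>2 - p\<^sup>2\<close>. If \<open>p\<close> is constant, \<open>q\<close> may vanish
  identically; then any point of the spectrum will do.\<close>

lemma norm_poly_op_attained:
  assumes A: "hermitian A" and "poly_op p A \<noteq> 0"
  shows "\<exists>t\<in>real_spectrum A. \<bar>poly p t\<bar> = norm (poly_op p A)"
proof -
  have root: "\<exists>t\<in>real_spectrum A. (poly p t)\<^sup>2 = (norm (poly_op p A))\<^sup>2"
    if "[:(norm (poly_op p A))\<^sup>2:] - p * p \<noteq> 0" "poly_op p A \<noteq> 0" for p
  proof -
    have "\<not> invertible_op (poly_op ([:(norm (poly_op p A))\<^sup>2:] - p * p) A)"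
      unfolding poly_op_diff poly_op_mult poly_op_const
      by (intro hermitian_norm_not_invertible hermitian_poly_op A that)
    from poly_op_not_invertible_root[OF A that(1) this] show ?thesis
      by (auto simp: power2_eq_square)
  qed
  \<comment> \<open>Either \<open>A = 0\<close>, or \<open>\<parallel>A\<parallel>\<^sup>2 - X\<^sup>2\<close> is a nonzero polynomial to which \<open>root\<close> applies.\<close>
  have nonempty: "\<exists>t. t \<in> real_spectrum A"
  proof (cases "A = 0")
    case True
    have "\<not> invertible_op A"
    proof
      assume "invertible_op A"
      then have "id_blinfun = (0 :: 'a \<Rightarrow>\<^sub>L 'a)" using True by (auto simp: invertible_op_def)
      then have "x = 0" for x :: 'a
        by (metis blinfun.zero_left blinfun_apply_id_blinfun)
      then have "blinfun_apply (poly_op p A) y = 0" for y by blast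
      then have "poly_op p A = 0" by (intro blinfun_eqI) (simp add: blinfun.zero_left)
      then show False using assms(2) by simp
    qed
    then have "0 \<in> real_spectrum A" by (simp add: real_spectrum_iff)
    then show ?thesis ..
  next
    case False
    have "poly_op [:0, 1:] A = A" by (simp add: poly_op_linear)
    then show ?thesis using root[of "[:0, 1:]"] False by auto
  qed
  have "\<exists>t\<in>real_spectrum A. (poly p t)\<^sup>2 = (norm (poly_op p A))\<^sup>2"
  proof (cases "[:(norm (poly_op p A))\<^sup>2:] - p * p = 0")
    case True
    then have "p * p = [:(norm (poly_op p A))\<^sup>2:]" by simp
    then have "poly (p * p) t = (norm (poly_op p A))\<^sup>2" for t
      by (simp only: poly_pCons poly_0 mult_zero_right add_0_right)
    then have "(poly p t)\<^sup>2 = (norm (poly_op p A))\<^sup>2" for t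
      by (simp only: poly_mult power2_eq_square)
    then show ?thesis using nonempty by blast
  next
    case False
    then show ?thesis by (rule root) fact
  qed
  then obtain t where t: "t \<in> real_spectrum A" "\<bar>poly p t\<bar>\<^sup>2 = (norm (poly_op p A))\<^sup>2"
    by auto
  then have "\<bar>poly p t\<bar> = norm (poly_op p A)"
    by (rule_tac power2_eq_imp_eq) simp_all
  with t(1) show ?thesis ..
qed

lemma norm_poly_op_le:
  assumes "hermitian A" and "0 \<le> c" and "\<And>t. t \<in> real_spectrum A \<Longrightarrow> \<bar>poly p t\<bar> \<le> c"
  shows "norm (poly_op p A) \<le> c"
proof (cases "poly_op p A = 0")
  case True
  then show ?thesis using assms(2) by simp
next
  case False
  then obtain t where "t \<in> real_spectrum A" "\<bar>poly p t\<bar> = norm (poly_op p A)"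
    using norm_poly_op_attained[OF assms(1)] by blast
  then show ?thesis using assms(3)[of t] by simp
qed

section \<open>Continuous functional calculus\<close>

lemma uniform_poly_approximation:
  fixes f :: "real \<Rightarrow> real"
  assumes "compact S" and "continuous_on S f"
  obtains p :: "nat \<Rightarrow> real poly" where "uniform_limit S (\<lambda>n. poly (p n)) f sequentially"
proof -
  have "\<exists>p. \<forall>x\<in>S. \<bar>f x - poly p x\<bar> < inverse (real (Suc n))" for n
  proof -
    obtain u where u: "real_polynomial_function u"
        "\<And>x. x \<in> S \<Longrightarrow> \<bar>f x - u x\<bar> < inverse (real (Suc n))"
      using Stone_Weierstrass_real_polynomial_function[OF assms, of "inverse (real (Suc n))"]
      by auto
    obtain a k where "u = (\<lambda>x. \<Sum>i\<le>k. a i * x ^ i)"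
      using u(1) by (auto simp: real_polynomial_function_iff_sum)
    then have "u = poly (\<Sum>i\<le>k. monom (a i) i)" by (simp add: fun_eq_iff poly_sum poly_monom)
    then show ?thesis using u(2) by auto
  qed
  then obtain p where p: "\<And>n x. x \<in> S \<Longrightarrow> \<bar>f x - poly (p n) x\<bar> < inverse (real (Suc n))"
    by metis
  have "uniform_limit S (\<lambda>n. poly (p n)) f sequentially"
  proof (rule uniform_limitI)
    fix e :: real assume "0 < e"
    have "(\<lambda>n. inverse (real (Suc n))) \<longlonglongrightarrow> 0" by (rule LIMSEQ_inverse_real_of_nat)
    then have "\<forall>\<^sub>F n in sequentially. inverse (real (Suc n)) < e"
      using \<open>0 < e\<close> by (rule order_tendstoD)
    then show "\<forall>\<^sub>F n in sequentially. \<forall>x\<in>S. dist (poly (p n) x) (f x) < e"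
    proof eventually_elim
      case (elim n)
      show ?case
      proof
        fix x assume "x \<in> S"
        then show "dist (poly (p n) x) (f x) < e"
          using p[of x n] elim by (simp add: dist_real_def abs_minus_commute)
      qed
    qed
  qed
  then show ?thesis by (rule that)
qed

lemma Cauchy_poly_op:
  assumes A: "hermitian A"
    and lim: "uniform_limit (real_spectrum A) (\<lambda>n. poly (p n)) f sequentially"
  shows "Cauchy (\<lambda>n. poly_op (p n) A)"
proof (rule metric_CauchyI)
  fix e :: real assume "0 < e"
  then obtain N where N: "\<And>n t. N \<le> n \<Longrightarrow> t \<in> real_spectrum A \<Longrightarrow> dist (poly (p n) t) (f t) < e / 3"
    using uniform_limitD[OF lim, of "e / 3"] by (auto simp: eventually_sequentially)
  have "dist (poly_op (p m) A) (poly_op (p n) A) < e" if "N \<le> m" "N \<le> n" for m n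
  proof -
    have "norm (poly_op (p m - p n) A) \<le> 2 * e / 3"
    proof (rule norm_poly_op_le[OF A])
      fix t assume "t \<in> real_spectrum A"
      then show "\<bar>poly (p m - p n) t\<bar> \<le> 2 * e / 3"
        using N[OF that(1), of t] N[OF that(2), of t] unfolding dist_real_def poly_diff by linarith
    qed (use \<open>0 < e\<close> in simp)
    then show ?thesis using \<open>0 < e\<close> by (simp add: dist_norm poly_op_diff)
  qed
  then show "\<exists>N. \<forall>m\<ge>N. \<forall>n\<ge>N. dist (poly_op (p m) A) (poly_op (p n) A) < e" by blast
qed

lemma poly_op_same_limit:
  assumes A: "hermitian A"
    and p: "uniform_limit (real_spectrum A) (\<lambda>n. poly (p n)) f sequentially"
    and q: "uniform_limit (real_spectrum A) (\<lambda>n. poly (q n)) f sequentially"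
  shows "(\<lambda>n. poly_op (p n) A - poly_op (q n) A) \<longlonglongrightarrow> 0"
proof (rule LIMSEQ_I)
  fix e :: real assume "0 < e"
  have "uniform_limit (real_spectrum A) (\<lambda>n. poly (p n - q n)) (\<lambda>t. f t - f t) sequentially"
    unfolding poly_diff by (rule uniform_limit_minus[OF p q])
  then obtain N where N: "\<And>n t. N \<le> n \<Longrightarrow> t \<in> real_spectrum A \<Longrightarrow> \<bar>poly (p n - q n) t\<bar> < e / 2"
    using \<open>0 < e\<close> uniform_limitD[of _ _ _ sequentially "e / 2"]
    by (fastforce simp: eventually_sequentially)
  have "norm (poly_op (p n) A - poly_op (q n) A) \<le> e / 2" if "N \<le> n" for n
    unfolding poly_op_diff[symmetric]
    by (rule norm_poly_op_le[OF A]) (use \<open>0 < e\<close> N[OF that] in \<open>auto simp: less_imp_le simp del: poly_diff\<close>)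
  then show "\<exists>N. \<forall>n\<ge>N. norm (poly_op (p n) A - poly_op (q n) A - 0) < e"
    using \<open>0 < e\<close> by (intro exI[of _ N]) force
qed

text \<open>The limit exists and is independent of the polynomials since \<open>p \<mapsto> p(A)\<close> is contractive for the
  supremum norm on the spectrum. Continuity of \<open>f\<close> on a compact set around the spectrum provides an approximating sequence;
  without one, every operator would satisfy the description that defines \<open>f(A)\<close>.\<close>

lemma poly_op_tendsto_cfc:
  fixes A :: "'a::complex_hilbert \<Rightarrow>\<^sub>L 'a"
  assumes A: "hermitian A" and S: "compact S" "real_spectrum A \<subseteq> S" "continuous_on S f"
    and p: "uniform_limit (real_spectrum A) (\<lambda>n. poly (p n)) f sequentially"
  shows "(\<lambda>n. poly_op (p n) A) \<longlonglongrightarrow> cfc f A"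
proof -
  let ?lim = "\<lambda>p :: nat \<Rightarrow> real poly. uniform_limit (real_spectrum A) (\<lambda>n. poly (p n)) f sequentially"
  obtain q where "uniform_limit S (\<lambda>n. poly (q n)) f sequentially"
    using uniform_poly_approximation[OF S(1,3)] by blast
  then have q: "?lim q" by (rule uniform_limit_on_subset) (rule S)
  obtain T where T: "(\<lambda>n. poly_op (q n) A) \<longlonglongrightarrow> T"
    using Cauchy_poly_op[OF A q] by (auto simp: Cauchy_convergent_iff convergent_def)
  have all: "(\<lambda>n. poly_op (r n) A) \<longlonglongrightarrow> T" if "?lim r" for r
    using tendsto_add[OF poly_op_same_limit[OF A that q] T] by simp
  have "cfc f A = T"
    unfolding cfc_def real_spectrum_def[symmetric]
  proof (rule the_equality)
    show "\<forall>r. ?lim r \<longrightarrow> (\<lambda>n. poly_op (r n) A) \<longlonglongrightarrow> T" using all by blast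
    show "U = T" if "\<forall>r. ?lim r \<longrightarrow> (\<lambda>n. poly_op (r n) A) \<longlonglongrightarrow> U" for U
      using that q T LIMSEQ_unique by blast
  qed
  then show ?thesis using all[OF p] by simp
qed

lemma cfc_approximation:
  assumes "hermitian A" and "compact S" and "real_spectrum A \<subseteq> S" and "continuous_on S f"
  obtains p where "uniform_limit S (\<lambda>n. poly (p n)) f sequentially"
    and "(\<lambda>n. poly_op (p n) A) \<longlonglongrightarrow> cfc f A"
proof -
  obtain p where p: "uniform_limit S (\<lambda>n. poly (p n)) f sequentially"
    using uniform_poly_approximation[OF assms(2,4)] by blast
  show ?thesis
    using that p poly_op_tendsto_cfc[OF assms uniform_limit_on_subset[OF p assms(3)]] by blast
qed

lemma cfc_poly:
  assumes "hermitian A" and "compact S" and "real_spectrum A \<subseteq> S"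
    and f: "\<And>t. t \<in> S \<Longrightarrow> f t = poly q t"
  shows "cfc f A = poly_op q A"
proof -
  have "continuous_on S f"
    using f by (subst continuous_on_cong[OF refl, of _ _ "poly q"]) (auto intro: continuous_intros)
  moreover have "uniform_limit (real_spectrum A) (\<lambda>n::nat. poly q) f sequentially"
    using f assms(3) by (auto intro!: uniform_limitI simp: subset_eq)
  ultimately have "(\<lambda>n::nat. poly_op q A) \<longlonglongrightarrow> cfc f A"
    using assms by (intro poly_op_tendsto_cfc[where S = S]) auto
  then show ?thesis by (simp add: LIMSEQ_const_iff)
qed

lemma hermitian_cfc:
  assumes "hermitian A" and "compact S" and "real_spectrum A \<subseteq> S" and "continuous_on S f"
  shows "hermitian (cfc f A)"
  using cfc_approximation[OF assms] hermitian_limit hermitian_poly_op[OF assms(1)] by metis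

lemma cfc_add:
  assumes A: "hermitian A" and S: "compact S" "real_spectrum A \<subseteq> S"
    and fg: "continuous_on S f" "continuous_on S u"
  shows "cfc (\<lambda>t. f t + u t) A = cfc f A + cfc u A"
proof -
  obtain p where p: "uniform_limit S (\<lambda>n. poly (p n)) f sequentially"
      "(\<lambda>n. poly_op (p n) A) \<longlonglongrightarrow> cfc f A" using cfc_approximation[OF A S fg(1)] .
  obtain q where q: "uniform_limit S (\<lambda>n. poly (q n)) u sequentially"
      "(\<lambda>n. poly_op (q n) A) \<longlonglongrightarrow> cfc u A" using cfc_approximation[OF A S fg(2)] .
  have "uniform_limit S (\<lambda>n. poly (p n + q n)) (\<lambda>t. f t + u t) sequentially"
    unfolding poly_add by (rule uniform_limit_add[OF p(1) q(1)])
  then have "(\<lambda>n. poly_op (p n + q n) A) \<longlonglongrightarrow> cfc (\<lambda>t. f t + u t) A"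
    by (intro poly_op_tendsto_cfc[OF A S]) (auto intro!: continuous_intros fg
        intro: uniform_limit_on_subset[OF _ S(2)])
  moreover have "(\<lambda>n. poly_op (p n + q n) A) \<longlonglongrightarrow> cfc f A + cfc u A"
    unfolding poly_op_add by (rule tendsto_add[OF p(2) q(2)])
  ultimately show ?thesis by (rule LIMSEQ_unique)
qed

lemma cfc_mult:
  assumes A: "hermitian A" and S: "compact S" "real_spectrum A \<subseteq> S"
    and fg: "continuous_on S f" "continuous_on S u"
  shows "cfc (\<lambda>t. f t * u t) A = cfc f A o\<^sub>L cfc u A"
proof -
  obtain p where p: "uniform_limit S (\<lambda>n. poly (p n)) f sequentially"
      "(\<lambda>n. poly_op (p n) A) \<longlonglongrightarrow> cfc f A" using cfc_approximation[OF A S fg(1)] .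
  obtain q where q: "uniform_limit S (\<lambda>n. poly (q n)) u sequentially"
      "(\<lambda>n. poly_op (q n) A) \<longlonglongrightarrow> cfc u A" using cfc_approximation[OF A S fg(2)] .
  have "bounded (f ` S)" "bounded (u ` S)"
    using fg S(1) by (simp_all add: compact_continuous_image compact_imp_bounded)
  then have "uniform_limit S (\<lambda>n. poly (p n * q n)) (\<lambda>t. f t * u t) sequentially"
    unfolding poly_mult by (intro uniform_lim_mult p q)
  then have "(\<lambda>n. poly_op (p n * q n) A) \<longlonglongrightarrow> cfc (\<lambda>t. f t * u t) A"
    by (intro poly_op_tendsto_cfc[OF A S]) (auto intro!: continuous_intros fg
        intro: uniform_limit_on_subset[OF _ S(2)])
  moreover have "(\<lambda>n. poly_op (p n * q n) A) \<longlonglongrightarrow> (cfc f A o\<^sub>L cfc u A)"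
    unfolding poly_op_mult by (intro tendsto_intros p q)
  ultimately show ?thesis by (rule LIMSEQ_unique)
qed

text \<open>A polynomial with \<open>0 \<le> q \<le> c\<close> on the spectrum satisfies \<open>\<bar>c - q\<bar> \<le> c\<close> there, hence
  \<open>\<parallel>c x - q(A) x\<parallel> \<le> c \<parallel>x\<parallel>\<close>; squaring yields \<open>0 \<le> \<parallel>q(A) x\<parallel>\<^sup>2 \<le> 2 c \<langle>q(A) x, x\<rangle>\<close>.\<close>

lemma poly_op_nonneg:
  assumes A: "hermitian A" and "bounded (poly q ` real_spectrum A)"
    and nonneg: "\<And>t. t \<in> real_spectrum A \<Longrightarrow> 0 \<le> poly q t"
  shows "0 \<le> Re (cinner (poly_op q A x) x)"
proof -
  obtain c where c: "0 < c" "\<And>t. t \<in> real_spectrum A \<Longrightarrow> \<bar>poly q t\<bar> \<le> c"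
    using assms(2) by (auto simp: bounded_pos)
  let ?Q = "poly_op q A"
  have "norm (poly_op ([:c:] - q) A) \<le> c"
    using c nonneg by (intro norm_poly_op_le[OF A]) force+
  then have "norm (poly_op ([:c:] - q) A x) \<le> c * norm x"
    by (meson norm_blinfun mult_right_mono norm_ge_zero order_trans)
  then have "norm (c *\<^sub>R x - ?Q x) \<le> c * norm x"
    by (simp add: poly_op_diff poly_op_const blinfun.diff_left blinfun.scaleR_left)
  then have "(norm (c *\<^sub>R x - ?Q x))\<^sup>2 \<le> (c * norm x)\<^sup>2"
    by (rule power_mono) simp
  then have "(norm (?Q x))\<^sup>2 \<le> c * (2 * Re (cinner (?Q x) x))"
    by (simp add: norm_diff_squared power_mult_distrib cinner_scaleR_left Re_cinner_commute[of x])
  then have "0 \<le> c * (2 * Re (cinner (?Q x) x))" by (meson order_trans zero_le_power2)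
  then show ?thesis using c(1) by (simp add: zero_le_mult_iff)
qed

text \<open>The approximating polynomials may be negative, but adding any \<open>e > 0\<close> eventually makes them
  nonnegative on the spectrum.\<close>

lemma positive_cfc:
  assumes A: "hermitian A" and S: "compact S" "real_spectrum A \<subseteq> S" "continuous_on S f"
    and nonneg: "\<And>t. t \<in> S \<Longrightarrow> 0 \<le> f t"
  shows "positive_op (cfc f A)"
  unfolding positive_op_iff_hermitian[OF hermitian_cfc[OF A S]]
proof
  fix x
  obtain p where p: "uniform_limit S (\<lambda>n. poly (p n)) f sequentially"
      "(\<lambda>n. poly_op (p n) A) \<longlonglongrightarrow> cfc f A" using cfc_approximation[OF A S] .
  let ?r = "Re (cinner (cfc f A x) x)"
  have lim: "(\<lambda>n. Re (cinner (poly_op (p n) A x) x)) \<longlonglongrightarrow> ?r"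
    by (intro tendsto_Re tendsto_cinner_blinfun p)
  have ge: "- e * (norm x)\<^sup>2 \<le> ?r" if "0 < e" for e :: real
  proof (rule tendsto_lowerbound[OF lim])
    show "\<forall>\<^sub>F n in sequentially. - e * (norm x)\<^sup>2 \<le> Re (cinner (poly_op (p n) A x) x)"
      using uniform_limitD[OF p(1) that]
    proof eventually_elim
      case (elim n)
      have "0 \<le> Re (cinner (poly_op (p n + [:e:]) A x) x)"
      proof (rule poly_op_nonneg[OF A])
        have "bounded (poly (p n + [:e:]) ` S)"
          by (intro compact_imp_bounded compact_continuous_image S continuous_intros)
        then show "bounded (poly (p n + [:e:]) ` real_spectrum A)"
          using S(2) by (meson bounded_subset image_mono)
        show "0 \<le> poly (p n + [:e:]) t" if "t \<in> real_spectrum A" for t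
          using elim nonneg[of t] S(2) that by (force simp: dist_real_def)
      qed
      then show ?case
        by (simp add: poly_op_add poly_op_const blinfun.add_left blinfun.scaleR_left
            cinner_add_left cinner_scaleR_left power2_norm_eq_cinner)
    qed
  qed simp
  show "0 \<le> ?r"
  proof (rule field_le_epsilon)
    fix e :: real assume "0 < e"
    have pos: "0 < (norm x)\<^sup>2 + 1" by (simp add: add_nonneg_pos)
    then have "e / ((norm x)\<^sup>2 + 1) * (norm x)\<^sup>2 \<le> e"
      using \<open>0 < e\<close> by (simp add: pos_divide_le_eq)
    moreover have "0 < e / ((norm x)\<^sup>2 + 1)" using \<open>0 < e\<close> pos by simp
    ultimately show "0 \<le> ?r + e" using ge[of "e / ((norm x)\<^sup>2 + 1)"] by simp
  qed
qed

section \<open>The scalar inequalities\<close>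

lemma convex_on_g:
  assumes "0 \<le> v" and "v \<le> 1"
  shows "convex_on {0<..} (g v)"
proof (rule f''_ge0_imp_convex)
  fix x :: real assume "x \<in> {0<..}"
  then have x: "0 < x" by simp
  show "(g v has_real_derivative v - v * x powr (v - 1)) (at x)"
    unfolding g_def[abs_def] using x by (auto intro!: derivative_eq_intros)
  show "((\<lambda>x. v - v * x powr (v - 1)) has_real_derivative v * (1 - v) * x powr (v - 2)) (at x)"
    using x by (auto intro!: derivative_eq_intros simp: algebra_simps)
  show "0 \<le> v * (1 - v) * x powr (v - 2)"
    using assms by simp
qed simp

lemma g_le_max:
  assumes "v \<in> {0..1}" and "0 < a" and "t \<in> {a..b}"
  shows "g v t \<le> max (g v b) (g v a)"
proof -
  have "convex_on {a..b} (g v)"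
    using assms by (intro convex_on_subset[OF convex_on_g]) auto
  then have "g v t \<le> max (g v a) (g v b)"
    using convex_on_le_max assms(3) by blast
  then show ?thesis by (simp add: max.commute)
qed

lemma log_mean_ln_specht:
  assumes "0 < x" and "x \<noteq> 1"
  defines "L \<equiv> log_mean 1 x"
  shows "0 < L" and "L * ln (specht_ratio x) = 1 - L + L * ln L"
proof -
  have L: "L = (x - 1) / ln x" by (simp add: L_def log_mean_def)
  show "0 < L"
    using assms(1,2) by (cases "x < 1") (auto simp: L intro: divide_neg_neg)
  have "ln (x powr (1 / (x - 1))) = 1 / L"
    using assms(1) by (simp add: L ln_powr)
  moreover have "x powr (1 / (x - 1)) = exp (1 / L)"
    using assms(1) by (simp add: L powr_def)
  ultimately have "specht_ratio x = exp (1 / L) / (exp 1 * (1 / L))"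
    by (simp add: specht_ratio_def)
  then have "ln (specht_ratio x) = 1 / L - 1 + ln L"
    using \<open>0 < L\<close> by (simp add: ln_div ln_mult)
  then show "L * ln (specht_ratio x) = 1 - L + L * ln L"
    using \<open>0 < L\<close> by (simp add: field_simps)
qed

text \<open>With \<open>L = L(1, x)\<close> and \<open>u = x\<^sup>v\<close> the linear part is \<open>v (x - 1) = L ln u\<close>, so
  \<open>g\<^sub>v(x) = 1 + L ln u - u\<close>, which is largest at \<open>u = L\<close>.\<close>

lemma g_le_log_mean_specht:
  assumes "0 < x" and "x \<noteq> 1"
  shows "g v x \<le> log_mean 1 x * ln (specht_ratio x)"
proof -
  define L where "L = log_mean 1 x"
  define u where "u = x powr v"
  have L: "0 < L" "L * ln (specht_ratio x) = 1 - L + L * ln L"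
    using log_mean_ln_specht[OF assms] by (simp_all add: L_def)
  have "0 < u" using assms by (simp add: u_def)
  have "ln x \<noteq> 0" using assms by simp
  then have "v * (x - 1) = L * ln u"
    using assms by (simp add: u_def L_def log_mean_def ln_powr)
  then have "g v x = 1 + L * ln u - u"
    by (simp add: g_def u_def algebra_simps)
  also have "L * ln u \<le> L * (ln L + (u / L - 1))"
    using ln_le_minus_one[of "u / L"] L(1) \<open>0 < u\<close> by (simp add: ln_div)
  then have "1 + L * ln u - u \<le> 1 - L + L * ln L"
    using L(1) by (simp add: algebra_simps)
  finally show ?thesis using L(2) by (simp add: L_def)
qed

lemma log_mean_specht_inverse:
  assumes "1 < h"
  shows "log_mean 1 (1 / h) * ln (specht_ratio (1 / h)) = log_mean 1 h * ln (specht_ratio h) / h"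
proof -
  define L where "L = log_mean 1 h"
  have L: "0 < L" "L * ln (specht_ratio h) = 1 - L + L * ln L"
    using log_mean_ln_specht[of h] assms by (simp_all add: L_def)
  have L': "log_mean 1 (1 / h) = L / h"
    using assms by (simp add: L_def log_mean_def ln_div field_simps)
  have Lh: "L * ln h = h - 1" using assms by (simp add: L_def log_mean_def)
  have "log_mean 1 (1 / h) * ln (specht_ratio (1 / h)) = 1 - L / h + L / h * ln (L / h)"
    using log_mean_ln_specht(2)[of "1 / h"] assms by (simp add: L')
  also have "\<dots> = (h - L + L * ln L - L * ln h) / h"
    using L(1) assms by (simp add: ln_div field_simps)
  also have "\<dots> = L * ln (specht_ratio h) / h"
    by (simp add: Lh L(2))
  finally show ?thesis by (simp add: L_def)
qed

text \<open>Since \<open>S(1/h) = S(h)\<close> and \<open>L(1, 1/h) = L(1, h) / h\<close>, the bound for \<open>g\<^sub>v(1/h)\<close> is \<open>1/h\<close> times the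
  one for \<open>g\<^sub>v(h)\<close>; the latter is nonnegative because it also bounds \<open>g\<^sub>0(h) = 0\<close>.\<close>

lemma max_g_le_log_mean_specht:
  assumes "1 < h"
  shows "max (g v h) (g v (1 / h)) \<le> log_mean 1 h * ln (specht_ratio h)" (is "_ \<le> ?b")
proof -
  have "g 0 h \<le> ?b" by (rule g_le_log_mean_specht) (use assms in auto)
  then have "0 \<le> ?b" using assms by (simp add: g_def)
  have "g v (1 / h) \<le> ?b / h"
    unfolding log_mean_specht_inverse[OF assms, symmetric]
    by (rule g_le_log_mean_specht) (use assms in auto)
  also have "\<dots> \<le> ?b"
    using \<open>0 \<le> ?b\<close> assms by (simp add: divide_le_eq mult_le_cancel_left1)
  finally show ?thesis using g_le_log_mean_specht[of h v] assms by simp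
qed

section \<open>The operator inequalities\<close>

lemma op_le_scaleR_id_iff:
  assumes "hermitian T"
  shows "T \<le>\<^sub>o\<^sub>p c *\<^sub>R id_blinfun \<longleftrightarrow> (\<forall>x. Re (cinner (T x) x) \<le> c * (norm x)\<^sup>2)"
    and "c *\<^sub>R id_blinfun \<le>\<^sub>o\<^sub>p T \<longleftrightarrow> (\<forall>x. c * (norm x)\<^sup>2 \<le> Re (cinner (T x) x))"
proof -
  have "hermitian (c *\<^sub>R id_blinfun - T)" "hermitian (T - c *\<^sub>R id_blinfun)"
    by (intro hermitian_diff hermitian_scaleR hermitian_id assms)+
  then show "T \<le>\<^sub>o\<^sub>p c *\<^sub>R id_blinfun \<longleftrightarrow> (\<forall>x. Re (cinner (T x) x) \<le> c * (norm x)\<^sup>2)"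
    and "c *\<^sub>R id_blinfun \<le>\<^sub>o\<^sub>p T \<longleftrightarrow> (\<forall>x. c * (norm x)\<^sup>2 \<le> Re (cinner (T x) x))"
    by (simp_all add: op_le_def positive_op_iff_hermitian blinfun.diff_left blinfun.scaleR_left
        cinner_diff_left cinner_scaleR_left power2_norm_eq_cinner)
qed

lemma positive_op_scaleR: "positive_op T \<Longrightarrow> 0 \<le> r \<Longrightarrow> positive_op (r *\<^sub>R T)"
  by (simp add: positive_op_def blinfun.scaleR_left cinner_scaleR_left complex_nonneg_Reals_iff)

lemma scaleR_op_mono: "positive_op A \<Longrightarrow> r \<le> s \<Longrightarrow> r *\<^sub>R A \<le>\<^sub>o\<^sub>p s *\<^sub>R A"
  using positive_op_scaleR[of A "s - r"] by (simp add: op_le_def scaleR_left_diff_distrib)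

lemma op_powr_sqrt:
  assumes A: "hermitian A" and sp: "real_spectrum A \<subseteq> {m..M}" and "0 < m"
  defines "X \<equiv> op_powr A (1/2)" and "Y \<equiv> op_powr A (-1/2)"
  shows "hermitian X" and "hermitian Y"
    and "X o\<^sub>L X = A" and "X o\<^sub>L Y = id_blinfun" and "Y o\<^sub>L X = id_blinfun"
proof -
  let ?S = "{m..M}"
  have cont: "continuous_on ?S (\<lambda>t. t powr r)" for r
    using \<open>0 < m\<close> by (auto intro!: continuous_intros)
  have S: "compact ?S" by simp
  show "hermitian X" "hermitian Y"
    unfolding X_def Y_def op_powr_def by (intro hermitian_cfc[OF A S sp] cont)+
  have mult: "op_powr A r o\<^sub>L op_powr A s = poly_op q A"
    if "\<And>t. 0 < t \<Longrightarrow> t powr (r + s) = poly q t" for r s q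
    unfolding op_powr_def cfc_mult[OF A S sp cont cont, symmetric]
    by (rule cfc_poly[OF A S sp]) (use that \<open>0 < m\<close> in \<open>auto simp: powr_add\<close>)
  show "X o\<^sub>L X = A"
    unfolding X_def by (subst mult[of _ _ "[:0, 1:]"]) (auto simp: poly_op_linear)
  show "X o\<^sub>L Y = id_blinfun" "Y o\<^sub>L X = id_blinfun"
    unfolding X_def Y_def by (subst mult[of _ _ "[:1:]"]; simp add: poly_op_const)+
qed

text \<open>The affine function \<open>c - (1 - v) - v t\<close> and the power \<open>t\<^sup>v\<close> add up to \<open>c - g\<^sub>v(t)\<close>, which is
  nonnegative on \<open>{a..b}\<close>.\<close>

lemma positive_op_minus_g:
  assumes C: "hermitian C" and sp: "real_spectrum C \<subseteq> {a..b}" and "0 < a"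
    and c: "\<And>t. t \<in> {a..b} \<Longrightarrow> g v t \<le> c"
  shows "positive_op (c *\<^sub>R id_blinfun - arith_mean v id_blinfun C + op_powr C v)"
proof -
  let ?q = "[:c - (1 - v), - v:]"
  have S: "compact {a..b}" by simp
  have cont: "continuous_on {a..b} (poly ?q)" "continuous_on {a..b} (\<lambda>t. t powr v)"
    using \<open>0 < a\<close> by (auto intro!: continuous_intros)
  have "positive_op (cfc (\<lambda>t. poly ?q t + t powr v) C)"
    using c by (intro positive_cfc[OF C S sp] continuous_on_add cont) (simp add: g_def algebra_simps)
  moreover have "cfc (\<lambda>t. poly ?q t + t powr v) C = poly_op ?q C + op_powr C v"
    unfolding cfc_add[OF C S sp cont] op_powr_def by (simp add: cfc_poly[OF C S sp])
  moreover have "poly_op ?q C = c *\<^sub>R id_blinfun - arith_mean v id_blinfun C"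
    by (simp add: poly_op_linear arith_mean_def scaleR_left_diff_distrib)
  ultimately show ?thesis by simp
qed

theorem mainTheorem3:
  fixes A B :: "'a::complex_hilbert \<Rightarrow>\<^sub>L 'a" and m M v h :: real
  assumes "complex_linear A" and "complex_linear B"
    and "strictly_positive_op A" and "strictly_positive_op B"
    and "0 < m" and "m < M"
    and "m *\<^sub>R id_blinfun \<le>\<^sub>o\<^sub>p A" and "A \<le>\<^sub>o\<^sub>p M *\<^sub>R id_blinfun"
    and "m *\<^sub>R id_blinfun \<le>\<^sub>o\<^sub>p B" and "B \<le>\<^sub>o\<^sub>p M *\<^sub>R id_blinfun"
    and "v \<in> {0..1}" and "h = M / m"
  shows "arith_mean v A B - geom_mean v A B \<le>\<^sub>o\<^sub>p max (g v h) (g v (1 / h)) *\<^sub>R A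
    \<and> max (g v h) (g v (1 / h)) *\<^sub>R A \<le>\<^sub>o\<^sub>p (log_mean 1 h * ln (specht_ratio h)) *\<^sub>R A"
proof
  have h: "1 < h" using assms by simp
  have posA: "positive_op A" using assms by (simp add: strictly_positive_op_def)
  have A: "hermitian A" and B: "hermitian B"
    using assms by (auto intro: positive_op_imp_hermitian simp: strictly_positive_op_def)
  have boundA: "m * (norm x)\<^sup>2 \<le> Re (cinner (A x) x)" "Re (cinner (A x) x) \<le> M * (norm x)\<^sup>2"
    and boundB: "m * (norm x)\<^sup>2 \<le> Re (cinner (B x) x)" "Re (cinner (B x) x) \<le> M * (norm x)\<^sup>2" for x
    using assms(7-10) by (simp_all add: op_le_scaleR_id_iff A B)
  define X where "X = op_powr A (1/2)"
  define Y where "Y = op_powr A (-1/2)"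
  define C where "C = Y o\<^sub>L B o\<^sub>L Y"
  note XY = op_powr_sqrt[OF A real_spectrum_subset[OF boundA] \<open>0 < m\<close>, folded X_def Y_def]
  have XY_apply: "X (X x) = A x" "X (Y x) = x" "Y (X x) = x" for x
    using XY(3-5) by (metis blinfun_apply_blinfun_compose blinfun_apply_id_blinfun)+
  have C: "hermitian C" unfolding C_def by (intro hermitian_sandwich XY B)
  have C_form: "Re (cinner (C x) x) = Re (cinner (B (Y x)) (Y x))" for x
    using XY(2) by (simp add: C_def hermitianD)
  have A_form: "Re (cinner (A (Y x)) (Y x)) = (norm x)\<^sup>2" for x
    by (metis XY(1) XY_apply(1,2) hermitianD power2_norm_eq_cinner)
  \<comment> \<open>From \<open>A / h \<le> m \<le> B \<le> M \<le> h A\<close> and \<open>Y A Y = 1\<close>.\<close>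
  have "real_spectrum C \<subseteq> {1 / h..h}"
  proof (rule real_spectrum_subset)
    fix x
    have "1 / h * (norm x)\<^sup>2 \<le> m * (norm (Y x))\<^sup>2"
      using boundA(2)[of "Y x"] assms(5,6) by (simp add: A_form assms(12) field_simps)
    then show "1 / h * (norm x)\<^sup>2 \<le> Re (cinner (C x) x)"
      using boundB(1)[of "Y x"] by (simp add: C_form)
    have "M * (norm (Y x))\<^sup>2 \<le> h * (norm x)\<^sup>2"
      using boundA(1)[of "Y x"] assms(5,6) by (simp add: A_form assms(12) field_simps)
    then show "Re (cinner (C x) x) \<le> h * (norm x)\<^sup>2"
      using boundB(2)[of "Y x"] by (simp add: C_form)
  qed
  then have "positive_op (max (g v h) (g v (1 / h)) *\<^sub>R id_blinfun
      - arith_mean v id_blinfun C + op_powr C v)" (is "positive_op ?W")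
    using h assms(11) by (intro positive_op_minus_g[OF C] g_le_max) auto
  then have "positive_op (X o\<^sub>L ?W o\<^sub>L X)"
    by (rule positive_op_sandwich[OF XY(1)])
  also have "X o\<^sub>L ?W o\<^sub>L X
      = max (g v h) (g v (1 / h)) *\<^sub>R A - (arith_mean v A B - geom_mean v A B)"
  proof (rule blinfun_eqI)
    fix x
    have geom: "geom_mean v A B = X o\<^sub>L op_powr C v o\<^sub>L X"
      by (simp only: geom_mean_def X_def Y_def C_def)
    have "X (C (X x)) = B x" by (simp add: C_def XY_apply)
    then show "(X o\<^sub>L ?W o\<^sub>L X) x
        = (max (g v h) (g v (1 / h)) *\<^sub>R A - (arith_mean v A B - geom_mean v A B)) x"
      by (simp add: geom arith_mean_def blinfun.diff_left blinfun.add_left blinfun.scaleR_left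
        blinfun.diff_right blinfun.add_right blinfun.scaleR_right XY_apply)
  qed
  finally show "arith_mean v A B - geom_mean v A B \<le>\<^sub>o\<^sub>p max (g v h) (g v (1 / h)) *\<^sub>R A"
    by (simp add: op_le_def)
  show "max (g v h) (g v (1 / h)) *\<^sub>R A \<le>\<^sub>o\<^sub>p (log_mean 1 h * ln (specht_ratio h)) *\<^sub>R A"
    by (intro scaleR_op_mono posA max_g_le_log_mean_specht h)
qed

end
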